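(* (Schanuel's lemma) Given short exact sequences in $\mathrm{DVect}$ $$0\to K\xrightarrow{i}P\xrightarrow{\pi}M\to0\quad\text{and}\quad 0\to K'\xrightarrow{i'}P'\xrightarrow{\pi'}M\to0$$ with both $P$ and $P'$ projective, there is an isomorphism $K\oplus P'\cong K'\oplus P$ in $\mathrm{DVect}$.
   Context: A diffeological space is a set $X$ together with a specified set of functions $U\to X$ (called plots), for every open set $U\subseteq\mathbb{R}^n$ and every $n\in\mathbb{N}=\{0,1,2,\dots\}$, such that: (1) every constant map $U\to X$ is a plot; (2) if $U\to X$ is a plot and $V\to U$ is a smooth map between open subsets of Euclidean spaces, then $V\to U\to X$ is a plot; (3) if $U=\bigcup_i U_i$ is an open cover and $U\to X$ is a map whose restrictions to all $U_i$ are plots, then $U\to X$ is a plot. A map between diffeological spaces is smooth if composing with it sends plots to plots. Products carry the product diffeology (a map into a product is a plot iff all its components are plots), and $\mathbb{R}$ carries the standard diffeology. A diffeological vector space is a real vector space $V$ with a diffeology such that addition $V\times V\to V$ and scalar multiplication $\mathbb{R}\times V\to V$ are smooth. $\mathrm{DVect}$ is the category of diffeological vector spaces and smooth linear maps; an isomorphism in $\mathrm{DVect}$ is a smooth linear bijection with smooth inverse. The finite direct sum $\oplus$ in $\mathrm{DVect}$ is the product with the product diffeology. A map $f:X\to Y$ of diffeological spaces is an induction if it is injective and a map $q:U\to X$ is a plot iff $f\circ q$ is a plot of $Y$. It is a subduction if it is smooth, surjective, and every plot of $Y$ locally (near each point of its domain) lifts along $f$ to a plot of $X$. A sequence $0\to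 A\xrightarrow{i}E\xrightarrow{p}B\to0$ of smooth linear maps of diffeological vector spaces is a short exact sequence in $\mathrm{DVect}$ if it is a short exact sequence of vector spaces, $i$ is an induction and $p$ is a subduction. A diffeological vector space $V$ is projective if for every smooth linear subduction $f:W_1\to W_2$ of diffeological vector spaces and every smooth linear map $g:V\to W_2$ there exists a smooth linear map $h:V\to W_1$ with $g=f\circ h$. *)

theory Defs
  imports
    "HOL-Analysis.Analysis"
    "HOL-Algebra.Module"
    "HOL-Algebra.Algebraic_Closure_Type"
begin

section \<open>Smooth maps between open subsets of Euclidean spaces\<close>

text \<open>
  The dimension of the domain of a plot is an arbitrary natural number (including 0), so
  \<open>\<real>\<^sup>n\<close> is the library's \<^const>\<open>Euclidean_space\<close> \<open>n\<close>, i.e.\ the set of all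
  \<open>x :: nat \<Rightarrow> real\<close> with \<open>x i = 0\<close> for \<open>i \<ge> n\<close>. Functions on a subset \<open>U\<close> of it are total
  HOL functions whose values outside \<open>U\<close> are irrelevant.

  \<open>C_diff k n U f\<close>: the function \<open>f\<close> on the open set \<open>U \<subseteq> \<real>\<^sup>n\<close> is of class \<open>C\<^sup>k\<close>, i.e.\ all
  its iterated partial derivatives of order at most \<open>k\<close> exist and are continuous on \<open>U\<close>;
  \<open>x(i := t)\<close> varies the \<open>i\<close>-th coordinate only.
\<close>

primrec C_diff :: "nat \<Rightarrow> nat \<Rightarrow> (nat \<Rightarrow> real) set \<Rightarrow> ((nat \<Rightarrow> real) \<Rightarrow> real) \<Rightarrow> bool" where
  "C_diff 0 n U f \<longleftrightarrow> continuous_map (subtopology (Euclidean_space n) U) euclideanreal f"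
| "C_diff (Suc k) n U f \<longleftrightarrow>
     continuous_map (subtopology (Euclidean_space n) U) euclideanreal f \<and>
     (\<forall>i<n. \<exists>g. (\<forall>x\<in>U. ((\<lambda>t. f (x(i := t))) has_real_derivative g x) (at (x i))) \<and>
                C_diff k n U g)"

definition smooth_real :: "nat \<Rightarrow> (nat \<Rightarrow> real) set \<Rightarrow> ((nat \<Rightarrow> real) \<Rightarrow> real) \<Rightarrow> bool" where
  "smooth_real n U f \<longleftrightarrow> openin (Euclidean_space n) U \<and> (\<forall>k. C_diff k n U f)"

definition smooth_euclidean ::
  "nat \<Rightarrow> (nat \<Rightarrow> real) set \<Rightarrow> nat \<Rightarrow> (nat \<Rightarrow> real) set \<Rightarrow> ((nat \<Rightarrow> real) \<Rightarrow> nat \<Rightarrow> real) \<Rightarrow> bool" where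
  "smooth_euclidean m V n U h \<longleftrightarrow>
     openin (Euclidean_space m) V \<and> openin (Euclidean_space n) U \<and> h \<in> V \<rightarrow> U \<and>
     (\<forall>j<n. smooth_real m V (\<lambda>x. h x j))"

section \<open>Diffeological spaces\<close>

text \<open>
  For a diffeology \<open>D\<close>, \<open>D n U\<close> is the set of plots with domain the open set \<open>U \<subseteq> \<real>\<^sup>n\<close>. As a plot
  is a function defined on \<open>U\<close> only, membership in \<open>D n U\<close> must not depend on the values outside
  \<open>U\<close>; this is \<open>plot_cong\<close>.
\<close>

type_synonym 'a diffeology = "nat \<Rightarrow> (nat \<Rightarrow> real) set \<Rightarrow> ((nat \<Rightarrow> real) \<Rightarrow> 'a) set"

locale diffeological_space =
  fixes A :: "'a set" and D :: "'a diffeology"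
  assumes plot_open: "q \<in> D n U \<Longrightarrow> openin (Euclidean_space n) U"
    and plot_maps: "q \<in> D n U \<Longrightarrow> q \<in> U \<rightarrow> A"
    and plot_cong: "q \<in> D n U \<Longrightarrow> (\<And>x. x \<in> U \<Longrightarrow> q' x = q x) \<Longrightarrow> q' \<in> D n U"
    and plot_const: "openin (Euclidean_space n) U \<Longrightarrow> c \<in> A \<Longrightarrow> (\<lambda>_. c) \<in> D n U"
    and plot_comp: "q \<in> D n U \<Longrightarrow> smooth_euclidean m V n U h \<Longrightarrow> q \<circ> h \<in> D m V"
    and plot_glue: "(\<And>U. U \<in> \<U> \<Longrightarrow> q \<in> D n U) \<Longrightarrow> q \<in> D n (\<Union>\<U>)"

definition smooth_map ::
  "'a set \<Rightarrow> 'a diffeology \<Rightarrow> 'b set \<Rightarrow> 'b diffeology \<Rightarrow> ('a \<Rightarrow> 'b) \<Rightarrow> bool" where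
  "smooth_map A D B E f \<longleftrightarrow> f \<in> A \<rightarrow> B \<and> (\<forall>n U. \<forall>q \<in> D n U. f \<circ> q \<in> E n U)"

definition real_diffeology :: "real diffeology" where
  "real_diffeology n U = {q. smooth_real n U q}"

definition prod_diffeology :: "'a diffeology \<Rightarrow> 'b diffeology \<Rightarrow> ('a \<times> 'b) diffeology" where
  "prod_diffeology D E n U = {q. fst \<circ> q \<in> D n U \<and> snd \<circ> q \<in> E n U}"

definition diff_induction ::
  "'a set \<Rightarrow> 'a diffeology \<Rightarrow> 'b set \<Rightarrow> 'b diffeology \<Rightarrow> ('a \<Rightarrow> 'b) \<Rightarrow> bool" where
  "diff_induction A D B E f \<longleftrightarrow> f \<in> A \<rightarrow> B \<and> inj_on f A \<and>
     (\<forall>n U q. openin (Euclidean_space n) U \<longrightarrow> q \<in> U \<rightarrow> A \<longrightarrow> (q \<in> D n U \<longleftrightarrow> f \<circ> q \<in> E n U))"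

definition diff_subduction ::
  "'a set \<Rightarrow> 'a diffeology \<Rightarrow> 'b set \<Rightarrow> 'b diffeology \<Rightarrow> ('a \<Rightarrow> 'b) \<Rightarrow> bool" where
  "diff_subduction A D B E f \<longleftrightarrow> smooth_map A D B E f \<and> f ` A = B \<and>
     (\<forall>n U. \<forall>q \<in> E n U. \<forall>x \<in> U. \<exists>V. openin (Euclidean_space n) V \<and> x \<in> V \<and> V \<subseteq> U \<and>
        (\<exists>r \<in> D n V. \<forall>y \<in> V. f (r y) = q y))"

section \<open>Diffeological vector spaces\<close>

text \<open>
  A real vector space is a module over the field \<^typ>\<open>real\<close> in the sense of HOL-Algebra. The
  library's module record inherits the fields \<open>mult\<close> and \<open>one\<close> from rings; they play no role.
\<close>

record 'a dvect = "(real, 'a) module" +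
  plots :: "'a diffeology"

abbreviation real_ring :: "real ring" where
  "real_ring \<equiv> ring_of_type_algebra"

locale dvect_space =
  Module.module real_ring V + diffeological_space "carrier V" "plots V"
  for V :: "'a dvect" (structure) +
  assumes smooth_add:
    "smooth_map (carrier V \<times> carrier V) (prod_diffeology (plots V) (plots V))
       (carrier V) (plots V) (\<lambda>(x, y). x \<oplus> y)"
    and smooth_smult:
    "smooth_map (UNIV \<times> carrier V) (prod_diffeology real_diffeology (plots V))
       (carrier V) (plots V) (\<lambda>(c, x). c \<odot> x)"

definition linear_map :: "'a dvect \<Rightarrow> 'b dvect \<Rightarrow> ('a \<Rightarrow> 'b) \<Rightarrow> bool" where
  "linear_map V W f \<longleftrightarrow> f \<in> carrier V \<rightarrow> carrier W \<and>
     (\<forall>x \<in> carrier V. \<forall>y \<in> carrier V. f (x \<oplus>\<^bsub>V\<^esub> y) = f x \<oplus>\<^bsub>W\<^esub> f y) \<and>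
     (\<forall>c. \<forall>x \<in> carrier V. f (c \<odot>\<^bsub>V\<^esub> x) = c \<odot>\<^bsub>W\<^esub> f x)"

definition dvect_hom :: "'a dvect \<Rightarrow> 'b dvect \<Rightarrow> ('a \<Rightarrow> 'b) \<Rightarrow> bool" where
  "dvect_hom V W f \<longleftrightarrow>
     linear_map V W f \<and> smooth_map (carrier V) (plots V) (carrier W) (plots W) f"

definition dvect_iso :: "'a dvect \<Rightarrow> 'b dvect \<Rightarrow> ('a \<Rightarrow> 'b) \<Rightarrow> bool" where
  "dvect_iso V W f \<longleftrightarrow> dvect_hom V W f \<and> bij_betw f (carrier V) (carrier W) \<and>
     smooth_map (carrier W) (plots W) (carrier V) (plots V) (inv_into (carrier V) f)"

definition dvect_isomorphic :: "'a dvect \<Rightarrow> 'b dvect \<Rightarrow> bool" where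
  "dvect_isomorphic V W \<longleftrightarrow> dvect_space V \<and> dvect_space W \<and> (\<exists>f. dvect_iso V W f)"

definition dvect_sum :: "'a dvect \<Rightarrow> 'b dvect \<Rightarrow> ('a \<times> 'b) dvect" where
  "dvect_sum V W =
     \<lparr>carrier = carrier V \<times> carrier W,
      mult = undefined, one = undefined,
      zero = (\<zero>\<^bsub>V\<^esub>, \<zero>\<^bsub>W\<^esub>),
      add = (\<lambda>(v, w) (v', w'). (v \<oplus>\<^bsub>V\<^esub> v', w \<oplus>\<^bsub>W\<^esub> w')),
      smult = (\<lambda>c (v, w). (c \<odot>\<^bsub>V\<^esub> v, c \<odot>\<^bsub>W\<^esub> w)),
      plots = prod_diffeology (plots V) (plots W)\<rparr>"

definition short_exact ::
  "'a dvect \<Rightarrow> ('a \<Rightarrow> 'b) \<Rightarrow> 'b dvect \<Rightarrow> ('b \<Rightarrow> 'c) \<Rightarrow> 'c dvect \<Rightarrow> bool" where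
  "short_exact A i E p B \<longleftrightarrow>
     dvect_space A \<and> dvect_space E \<and> dvect_space B \<and> dvect_hom A E i \<and> dvect_hom E B p \<and>
     inj_on i (carrier A) \<and> i ` carrier A = {x \<in> carrier E. p x = \<zero>\<^bsub>B\<^esub>} \<and>
     p ` carrier E = carrier B \<and>
     diff_induction (carrier A) (plots A) (carrier E) (plots E) i \<and>
     diff_subduction (carrier E) (plots E) (carrier B) (plots B) p"

text \<open>
  HOL cannot quantify over all types inside a formula, so the type \<^typ>\<open>'a\<close> acts as the universe:
  the test spaces \<open>W\<^sub>1\<close>, \<open>W\<^sub>2\<close> range over all diffeological vector spaces whose underlying set is a
  subset of \<^typ>\<open>'a\<close> (with arbitrary operations and diffeology), as does \<open>V\<close> itself.
\<close>

definition dvect_projective :: "'a dvect \<Rightarrow> bool" where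
  "dvect_projective V \<longleftrightarrow> dvect_space V \<and>
     (\<forall>(W\<^sub>1 :: 'a dvect) (W\<^sub>2 :: 'a dvect) f g.
        dvect_space W\<^sub>1 \<longrightarrow> dvect_space W\<^sub>2 \<longrightarrow> dvect_hom W\<^sub>1 W\<^sub>2 f \<longrightarrow>
        diff_subduction (carrier W\<^sub>1) (plots W\<^sub>1) (carrier W\<^sub>2) (plots W\<^sub>2) f \<longrightarrow>
        dvect_hom V W\<^sub>2 g \<longrightarrow>
        (\<exists>h. dvect_hom V W\<^sub>1 h \<and> (\<forall>x \<in> carrier V. g x = f (h x))))"

end

theory Submission
  imports Defs
begin

text \<open>
  Projectivity of the two middle terms gives \<open>h : P \<rightarrow> P'\<close> and \<open>h' : P' \<rightarrow> P\<close> over \<open>M\<close>. The usual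
  proof identifies both \<open>K \<oplus> P'\<close> and \<open>K' \<oplus> P\<close> with the pullback of \<open>P\<close> and \<open>P'\<close> over \<open>M\<close>; composing
  the two identifications eliminates the pullback. The result sends \<open>(k, p')\<close> to the pair \<open>(k', p)\<close>
  with \<open>p = i k + h' p'\<close> and \<open>i' k' = p' - h p\<close>, and exchanging the roles of the two sequences gives
  its inverse. Smoothness of \<open>k'\<close> holds because \<open>i'\<close> is an induction.
\<close>

section \<open>Smooth linear maps\<close>

text \<open>The induction keeps \<open>c\<close> arbitrary because every partial derivative of a
  constant is the constant 0, to which the induction hypothesis must apply.\<close>

lemma C_diff_const: "C_diff k n U (\<lambda>_. c)"
proof (induction k arbitrary: c)
  case (Suc k)
  have "((\<lambda>_. c) has_real_derivative 0) (at t)" for t :: real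
    by simp
  then show ?case
    using Suc.IH[of 0] by (auto intro!: exI[of _ "\<lambda>_. 0"])
qed simp

lemma const_in_real_diffeology:
  "openin (Euclidean_space n) U \<Longrightarrow> (\<lambda>_. c) \<in> real_diffeology n U"
  by (simp add: real_diffeology_def smooth_real_def C_diff_const)

lemma smooth_map_plot: "smooth_map A D B E f \<Longrightarrow> q \<in> D n U \<Longrightarrow> f \<circ> q \<in> E n U"
  by (auto simp: smooth_map_def)

lemma dvect_homD:
  assumes "dvect_hom V W f"
  shows "x \<in> carrier V \<Longrightarrow> f x \<in> carrier W"
    and "x \<in> carrier V \<Longrightarrow> y \<in> carrier V \<Longrightarrow> f (x \<oplus>\<^bsub>V\<^esub> y) = f x \<oplus>\<^bsub>W\<^esub> f y"
    and "x \<in> carrier V \<Longrightarrow> f (c \<odot>\<^bsub>V\<^esub> x) = c \<odot>\<^bsub>W\<^esub> f x"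
    and "q \<in> plots V n U \<Longrightarrow> f \<circ> q \<in> plots W n U"
  using assms by (auto simp: dvect_hom_def linear_map_def smooth_map_def)

lemma dvect_homI:
  assumes "\<And>x. x \<in> carrier V \<Longrightarrow> f x \<in> carrier W"
    and "\<And>x y. x \<in> carrier V \<Longrightarrow> y \<in> carrier V \<Longrightarrow> f (x \<oplus>\<^bsub>V\<^esub> y) = f x \<oplus>\<^bsub>W\<^esub> f y"
    and "\<And>c x. x \<in> carrier V \<Longrightarrow> f (c \<odot>\<^bsub>V\<^esub> x) = c \<odot>\<^bsub>W\<^esub> f x"
    and "\<And>n U q. q \<in> plots V n U \<Longrightarrow> f \<circ> q \<in> plots W n U"
  shows "dvect_hom V W f"
  using assms by (auto simp: dvect_hom_def linear_map_def smooth_map_def)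

lemma dvect_hom_comp:
  assumes "dvect_hom V W f" and "dvect_hom W Z g"
  shows "dvect_hom V Z (g \<circ> f)"
  by (rule dvect_homI)
    (simp_all add: dvect_homD(1-3)[OF assms(1)] dvect_homD(1-3)[OF assms(2)] comp_assoc
      dvect_homD(4)[OF assms(2) dvect_homD(4)[OF assms(1)]])

section \<open>Sums, scalar multiples and differences in one space\<close>

context dvect_space
begin

lemma plus_plot:
  assumes "q \<in> plots V n U" and "r \<in> plots V n U"
  shows "(\<lambda>x. q x \<oplus> r x) \<in> plots V n U"
proof -
  have "(\<lambda>x. (q x, r x)) \<in> prod_diffeology (plots V) (plots V) n U"
    using assms by (simp add: prod_diffeology_def comp_def)
  from smooth_map_plot[OF smooth_add this] show ?thesis
    by (simp add: comp_def)
qed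

lemma smult_plot:
  assumes "c \<in> real_diffeology n U" and "q \<in> plots V n U"
  shows "(\<lambda>x. c x \<odot> q x) \<in> plots V n U"
proof -
  have "(\<lambda>x. (c x, q x)) \<in> prod_diffeology real_diffeology (plots V) n U"
    using assms by (simp add: prod_diffeology_def comp_def)
  from smooth_map_plot[OF smooth_smult this] show ?thesis
    by (simp add: comp_def)
qed

text \<open>The module laws come phrased with the operations of \<open>real_ring\<close>; here and
  in the next lemmas they are unfolded to ordinary arithmetic on the reals.\<close>

lemma smult_mem [simp]: "x \<in> carrier V \<Longrightarrow> c \<odot> x \<in> carrier V"
  using smult_closed[of c x] by (simp add: ring_of_type_algebra_def)

lemma smult_plus:
  "x \<in> carrier V \<Longrightarrow> y \<in> carrier V \<Longrightarrow> c \<odot> (x \<oplus> y) = c \<odot> x \<oplus> c \<odot> y"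
  using smult_r_distr[of c x y] by (simp add: ring_of_type_algebra_def)

lemma plus_smult: "x \<in> carrier V \<Longrightarrow> (c + d) \<odot> x = c \<odot> x \<oplus> d \<odot> x"
  using smult_l_distr[of c d x] by (simp add: ring_of_type_algebra_def)

lemma smult_smult: "x \<in> carrier V \<Longrightarrow> (c * d) \<odot> x = c \<odot> (d \<odot> x)"
  using smult_assoc1[of c d x] by (simp add: ring_of_type_algebra_def)

lemma one_smult: "x \<in> carrier V \<Longrightarrow> 1 \<odot> x = x"
  using smult_one[of x] by (simp add: ring_of_type_algebra_def)

lemma zero_smult: "x \<in> carrier V \<Longrightarrow> 0 \<odot> x = \<zero>"
  using smult_l_null[of x] by (simp add: ring_of_type_algebra_def)

text \<open>Smoothness and linearity speak of sums and scalar multiples only; this rewriting carries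
  both over to differences.\<close>

lemma minus_eq_smult:
  assumes "x \<in> carrier V" and "y \<in> carrier V"
  shows "x \<ominus> y = x \<oplus> (- 1) \<odot> y"
proof -
  have "(- 1) \<odot> y \<oplus> y = ((- 1) + 1) \<odot> y"
    using assms by (simp only: plus_smult one_smult)
  also have "\<dots> = \<zero>"
    using assms by (simp add: zero_smult)
  finally have "\<ominus> y = (- 1) \<odot> y"
    using assms by (intro minus_equality) auto
  then show ?thesis
    by (simp add: a_minus_def)
qed

lemma hom_add:
  assumes f: "dvect_hom W V f" and g: "dvect_hom W V g"
  shows "dvect_hom W V (\<lambda>x. f x \<oplus> g x)"
proof (rule dvect_homI)
  show "(\<lambda>x. f x \<oplus> g x) \<circ> q \<in> plots V n U" if "q \<in> plots W n U" for q n U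
    using plus_plot[OF dvect_homD(4)[OF f that] dvect_homD(4)[OF g that]]
    by (simp add: comp_def)
qed (simp_all add: dvect_homD[OF f] dvect_homD[OF g] smult_plus a_ac)

lemma hom_smult:
  assumes f: "dvect_hom W V f"
  shows "dvect_hom W V (\<lambda>x. c \<odot> f x)"
proof (rule dvect_homI)
  show "(\<lambda>x. c \<odot> f x) \<circ> q \<in> plots V n U" if "q \<in> plots W n U" for q n U
  proof -
    have fq: "f \<circ> q \<in> plots V n U"
      by (rule dvect_homD(4)[OF f that])
    \<comment> \<open>The fixed scalar is a constant plot of the reals on the domain of
      \<open>q\<close>, so joint smoothness of scalar multiplication applies.\<close>
    then have "(\<lambda>x. c \<odot> (f \<circ> q) x) \<in> plots V n U"
      by (intro smult_plot const_in_real_diffeology plot_open)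
    then show ?thesis
      by (simp add: comp_def)
  qed
qed (simp_all add: dvect_homD[OF f] smult_plus mult.commute flip: smult_smult)

lemma diff_add_cancel:
  "x \<in> carrier V \<Longrightarrow> y \<in> carrier V \<Longrightarrow> (x \<ominus> y) \<oplus> y = x"
  by (simp add: a_minus_def a_assoc l_neg)

lemma add_diff_cancel:
  "x \<in> carrier V \<Longrightarrow> y \<in> carrier V \<Longrightarrow> (x \<oplus> y) \<ominus> y = x"
  by (simp add: a_minus_def a_assoc r_neg)

end

text \<open>Being a homomorphism depends only on the values on the carrier: plots of
  \<open>V\<close> take values there, and \<open>plot_cong\<close> ignores all other points.\<close>

lemma dvect_hom_cong:
  assumes "dvect_space V" and "dvect_space W" and f: "dvect_hom V W f"
    and eq: "\<And>x. x \<in> carrier V \<Longrightarrow> g x = f x"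
  shows "dvect_hom V W g"
proof (rule dvect_homI)
  interpret V: dvect_space V by fact
  interpret W: dvect_space W by fact
  show "g \<circ> q \<in> plots W n U" if "q \<in> plots V n U" for q n U
    using W.plot_cong[OF dvect_homD(4)[OF f that], of "g \<circ> q"] V.plot_maps[OF that] eq
    by (auto simp: Pi_iff)
  fix x y c assume "x \<in> carrier V" "y \<in> carrier V"
  then show "g (x \<oplus>\<^bsub>V\<^esub> y) = g x \<oplus>\<^bsub>W\<^esub> g y" "g x \<in> carrier W" "g (c \<odot>\<^bsub>V\<^esub> x) = c \<odot>\<^bsub>W\<^esub> g x"
    by (simp_all add: eq dvect_homD[OF f])
qed

lemma dvect_hom_diff:
  assumes "dvect_space V" and "dvect_space W" and f: "dvect_hom V W f" and g: "dvect_hom V W g"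
  shows "dvect_hom V W (\<lambda>x. f x \<ominus>\<^bsub>W\<^esub> g x)"
proof -
  interpret W: dvect_space W by fact
  from assms(1,2) W.hom_add[OF f W.hom_smult[OF g]] show ?thesis
    by (rule dvect_hom_cong) (simp add: W.minus_eq_smult dvect_homD(1)[OF f] dvect_homD(1)[OF g])
qed

lemma dvect_hom_minus:
  assumes "dvect_space V" and "dvect_space W" and f: "dvect_hom V W f"
    and x: "x \<in> carrier V" "y \<in> carrier V"
  shows "f (x \<ominus>\<^bsub>V\<^esub> y) = f x \<ominus>\<^bsub>W\<^esub> f y"
proof -
  interpret V: dvect_space V by fact
  interpret W: dvect_space W by fact
  show ?thesis
    using x by (simp add: V.minus_eq_smult W.minus_eq_smult dvect_homD[OF f])
qed

text \<open>\<open>dvect_iso\<close> asks for smoothness of \<open>inv_into\<close>, which agrees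
  with the explicit inverse \<open>g\<close> on \<open>carrier W\<close>, so
  \<open>dvect_hom_cong\<close> transfers it.\<close>

lemma dvect_isoI:
  assumes "dvect_space V" and "dvect_space W"
    and f: "dvect_hom V W f" and g: "dvect_hom W V g"
    and gf: "\<And>x. x \<in> carrier V \<Longrightarrow> g (f x) = x"
    and fg: "\<And>y. y \<in> carrier W \<Longrightarrow> f (g y) = y"
  shows "dvect_iso V W f"
proof -
  have bij: "bij_betw f (carrier V) (carrier W)"
    by (rule bij_betw_byWitness[where f' = g])
       (auto simp: gf fg dvect_homD(1)[OF f] dvect_homD(1)[OF g])
  have "inv_into (carrier V) f y = g y" if "y \<in> carrier W" for y
    using that bij by (intro inv_into_f_eq) (auto simp: bij_betw_def fg dvect_homD(1)[OF g])
  then have "dvect_hom W V (inv_into (carrier V) f)"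
    by (rule dvect_hom_cong[OF assms(2,1) g])
  with f bij show ?thesis
    by (simp add: dvect_iso_def dvect_hom_def)
qed

section \<open>Direct sums\<close>

lemma dvect_sum_sel [simp]:
  "carrier (dvect_sum V W) = carrier V \<times> carrier W"
  "\<zero>\<^bsub>dvect_sum V W\<^esub> = (\<zero>\<^bsub>V\<^esub>, \<zero>\<^bsub>W\<^esub>)"
  "x \<oplus>\<^bsub>dvect_sum V W\<^esub> y = (fst x \<oplus>\<^bsub>V\<^esub> fst y, snd x \<oplus>\<^bsub>W\<^esub> snd y)"
  "c \<odot>\<^bsub>dvect_sum V W\<^esub> x = (c \<odot>\<^bsub>V\<^esub> fst x, c \<odot>\<^bsub>W\<^esub> snd x)"
  "plots (dvect_sum V W) = prod_diffeology (plots V) (plots W)"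
  by (simp_all add: dvect_sum_def case_prod_beta)

lemma diffeological_space_prod:
  assumes "diffeological_space A D" and "diffeological_space B E"
  shows "diffeological_space (A \<times> B) (prod_diffeology D E)"
proof -
  interpret D: diffeological_space A D by fact
  interpret E: diffeological_space B E by fact
  show ?thesis
  proof
    fix q n U assume q: "q \<in> prod_diffeology D E n U"
    then have q1: "fst \<circ> q \<in> D n U" and q2: "snd \<circ> q \<in> E n U"
      by (simp_all add: prod_diffeology_def)
    show "openin (Euclidean_space n) U"
      by (rule D.plot_open[OF q1])
    show "q \<in> U \<rightarrow> A \<times> B"
      using D.plot_maps[OF q1] E.plot_maps[OF q2] by (auto simp: Pi_iff mem_Times_iff)
    show "q' \<in> prod_diffeology D E n U" if "\<And>x. x \<in> U \<Longrightarrow> q' x = q x" for q'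
      using D.plot_cong[OF q1, of "fst \<circ> q'"] E.plot_cong[OF q2, of "snd \<circ> q'"] that
      by (simp add: prod_diffeology_def)
    show "q \<circ> h \<in> prod_diffeology D E m V" if "smooth_euclidean m V n U h" for h m V
      using D.plot_comp[OF q1 that] E.plot_comp[OF q2 that]
      by (simp add: prod_diffeology_def comp_assoc)
  next
    fix n U c assume "openin (Euclidean_space n) U" "c \<in> A \<times> B"
    then show "(\<lambda>_. c) \<in> prod_diffeology D E n U"
      by (auto simp: prod_diffeology_def comp_def intro: D.plot_const E.plot_const)
  next
    fix \<U> q n assume "\<And>U. U \<in> \<U> \<Longrightarrow> q \<in> prod_diffeology D E n U"
    then show "q \<in> prod_diffeology D E n (\<Union>\<U>)"
      by (auto simp: prod_diffeology_def intro: D.plot_glue E.plot_glue)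
  qed
qed

lemma dvect_space_sum:
  assumes "dvect_space V" and "dvect_space W"
  shows "dvect_space (dvect_sum V W)"
proof -
  interpret V: dvect_space V by fact
  interpret W: dvect_space W by fact
  have "abelian_group (dvect_sum V W)"
  proof (rule abelian_groupI)
    fix x assume "x \<in> carrier (dvect_sum V W)"
    then show "\<exists>y\<in>carrier (dvect_sum V W). y \<oplus>\<^bsub>dvect_sum V W\<^esub> x = \<zero>\<^bsub>dvect_sum V W\<^esub>"
      by (intro bexI[of _ "(\<ominus>\<^bsub>V\<^esub> fst x, \<ominus>\<^bsub>W\<^esub> snd x)"]) (auto simp: V.l_neg W.l_neg)
  qed (auto simp: V.a_ac W.a_ac)
  then have "Module.module real_ring (dvect_sum V W)"
    by (intro module.intro V.is_cring module_axioms.intro)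
       (auto simp: ring_of_type_algebra_def V.smult_plus W.smult_plus V.plus_smult W.plus_smult
         V.smult_smult W.smult_smult V.one_smult W.one_smult)
  moreover have "diffeological_space (carrier (dvect_sum V W)) (plots (dvect_sum V W))"
    by (simp add: diffeological_space_prod V.diffeological_space_axioms W.diffeological_space_axioms)
  moreover have "dvect_space_axioms (dvect_sum V W)"
  proof
    let ?D = "prod_diffeology (plots V) (plots W)"
    \<comment> \<open>A plot of pairs of pairs has four component plots; addition combines the two
      in \<open>V\<close> and the two in \<open>W\<close>.\<close>
    have "(\<lambda>(x, y). x \<oplus>\<^bsub>dvect_sum V W\<^esub> y) \<circ> q \<in> ?D n U" if "q \<in> prod_diffeology ?D ?D n U" for q n U
      using that V.plus_plot[of "fst \<circ> (fst \<circ> q)" n U "fst \<circ> (snd \<circ> q)"]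
        W.plus_plot[of "snd \<circ> (fst \<circ> q)" n U "snd \<circ> (snd \<circ> q)"]
      by (simp add: prod_diffeology_def comp_def case_prod_beta)
    then show "smooth_map (carrier (dvect_sum V W) \<times> carrier (dvect_sum V W))
        (prod_diffeology (plots (dvect_sum V W)) (plots (dvect_sum V W)))
        (carrier (dvect_sum V W)) (plots (dvect_sum V W)) (\<lambda>(x, y). x \<oplus>\<^bsub>dvect_sum V W\<^esub> y)"
      by (auto simp: smooth_map_def)
    have "(\<lambda>(c, x). c \<odot>\<^bsub>dvect_sum V W\<^esub> x) \<circ> q \<in> ?D n U"
      if "q \<in> prod_diffeology real_diffeology ?D n U" for q n U
      using that V.smult_plot[of "fst \<circ> q" n U "fst \<circ> (snd \<circ> q)"]
        W.smult_plot[of "fst \<circ> q" n U "snd \<circ> (snd \<circ> q)"]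
      by (simp add: prod_diffeology_def comp_def case_prod_beta)
    then show "smooth_map (UNIV \<times> carrier (dvect_sum V W))
        (prod_diffeology real_diffeology (plots (dvect_sum V W)))
        (carrier (dvect_sum V W)) (plots (dvect_sum V W)) (\<lambda>(c, x). c \<odot>\<^bsub>dvect_sum V W\<^esub> x)"
      by (auto simp: smooth_map_def)
  qed
  ultimately show ?thesis
    by (rule dvect_space.intro)
qed

lemma dvect_hom_fst: "dvect_hom (dvect_sum V W) V fst"
  by (rule dvect_homI) (auto simp: prod_diffeology_def)

lemma dvect_hom_snd: "dvect_hom (dvect_sum V W) W snd"
  by (rule dvect_homI) (auto simp: prod_diffeology_def)

lemma dvect_hom_Pair:
  assumes "dvect_hom Z V f" and "dvect_hom Z W g"
  shows "dvect_hom Z (dvect_sum V W) (\<lambda>x. (f x, g x))"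
proof (rule dvect_homI)
  show "(\<lambda>x. (f x, g x)) \<circ> q \<in> plots (dvect_sum V W) n U" if "q \<in> plots Z n U" for q n U
    using dvect_homD(4)[OF assms(1) that] dvect_homD(4)[OF assms(2) that]
    by (simp add: prod_diffeology_def comp_def)
qed (simp_all add: dvect_homD[OF assms(1)] dvect_homD[OF assms(2)])

section \<open>Short exact sequences\<close>

lemma short_exact_comp_zero:
  assumes "short_exact A i E p B" and "x \<in> carrier A"
  shows "p (i x) = \<zero>\<^bsub>B\<^esub>"
  using assms by (auto simp: short_exact_def)

text \<open>This is the universal property of \<open>i\<close> as a kernel of \<open>p\<close> in
  DVect. Exactness yields the factorization, injectivity of \<open>i\<close> its linearity, and the
  induction property its smoothness.\<close>

lemma short_exact_kernel_lift:
  assumes ex: "short_exact A i E p B" and "dvect_space W" and g: "dvect_hom W E g"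
    and pg: "\<And>x. x \<in> carrier W \<Longrightarrow> p (g x) = \<zero>\<^bsub>B\<^esub>"
  obtains k where "dvect_hom W A k" and "\<And>x. x \<in> carrier W \<Longrightarrow> i (k x) = g x"
proof -
  interpret A: dvect_space A using ex by (simp add: short_exact_def)
  interpret E: dvect_space E using ex by (simp add: short_exact_def)
  interpret W: dvect_space W by fact
  have i: "dvect_hom A E i" and inj: "inj_on i (carrier A)"
    and im: "i ` carrier A = {x \<in> carrier E. p x = \<zero>\<^bsub>B\<^esub>}"
    and ind: "diff_induction (carrier A) (plots A) (carrier E) (plots E) i"
    using ex by (simp_all add: short_exact_def)
  define k where "k = (\<lambda>x. inv_into (carrier A) i (g x))"
  have gim: "g x \<in> i ` carrier A" if "x \<in> carrier W" for x
    using that by (simp add: im pg dvect_homD(1)[OF g])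
  have k: "k x \<in> carrier A" and ik: "i (k x) = g x" if "x \<in> carrier W" for x
    using gim[OF that] by (simp_all add: k_def inv_into_into f_inv_into_f)
  have "dvect_hom W A k"
  proof (rule dvect_homI)
    fix x y assume "x \<in> carrier W" "y \<in> carrier W"
    then show "k (x \<oplus>\<^bsub>W\<^esub> y) = k x \<oplus>\<^bsub>A\<^esub> k y"
      \<comment> \<open>After applying the injective \<open>i\<close>, both sides become values of
        the linear map \<open>g\<close>.\<close>
      by (intro inj_onD[OF inj]) (simp_all add: k ik dvect_homD[OF i] dvect_homD[OF g])
  next
    fix c x assume "x \<in> carrier W"
    then show "k (c \<odot>\<^bsub>W\<^esub> x) = c \<odot>\<^bsub>A\<^esub> k x"
      by (intro inj_onD[OF inj]) (simp_all add: k ik dvect_homD[OF i] dvect_homD[OF g])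
  next
    fix n U q assume q: "q \<in> plots W n U"
    have qU: "q x \<in> carrier W" if "x \<in> U" for x
      using W.plot_maps[OF q] that by auto
    \<comment> \<open>This map agrees with the plot \<open>g \<circ> q\<close> on \<open>U\<close>;
      since \<open>i\<close> is an induction, \<open>k \<circ> q\<close> is then itself a
      plot.\<close>
    have "i \<circ> (k \<circ> q) \<in> plots E n U"
      by (rule E.plot_cong[OF dvect_homD(4)[OF g q]]) (simp add: ik qU)
    moreover have "k \<circ> q \<in> U \<rightarrow> carrier A"
      by (simp add: k qU)
    ultimately show "k \<circ> q \<in> plots A n U"
      using ind W.plot_open[OF q] unfolding diff_induction_def by blast
  qed (rule k)
  then show thesis
    using that ik by blast
qed

text \<open>The map \<open>p\<close> of a short exact sequence is a subduction, so projectivity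
  applies to it. All spaces share the type \<open>'a\<close> because the test spaces in
  \<open>dvect_projective\<close> range over that type.\<close>

lemma projective_lift:
  fixes V A E B :: "'a dvect"
  assumes "dvect_projective V" and "short_exact A i E p B" and "dvect_hom V B g"
  obtains h where "dvect_hom V E h" and "\<And>x. x \<in> carrier V \<Longrightarrow> p (h x) = g x"
proof -
  have "\<exists>h. dvect_hom V E h \<and> (\<forall>x \<in> carrier V. g x = p (h x))"
    using assms unfolding dvect_projective_def short_exact_def by blast
  then show thesis
    using that by metis
qed

section \<open>The two mutually inverse homomorphisms\<close>

text \<open>Exchanging the two sequences in this statement yields the map in the other direction.
  The two equations on \<open>F\<close> are all that the inverse argument needs to know about its
  values.\<close>

lemma schanuel_hom:
  assumes ex: "short_exact K i P \<pi> M" and ex': "short_exact K' i' P' \<pi>' M"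
    and h: "dvect_hom P P' h" and \<pi>h: "\<And>x. x \<in> carrier P \<Longrightarrow> \<pi>' (h x) = \<pi> x"
    and h': "dvect_hom P' P h'" and \<pi>h': "\<And>x. x \<in> carrier P' \<Longrightarrow> \<pi> (h' x) = \<pi>' x"
  obtains F where "dvect_hom (dvect_sum K P') (dvect_sum K' P) F"
    and "\<And>x. x \<in> carrier (dvect_sum K P') \<Longrightarrow> snd (F x) = i (fst x) \<oplus>\<^bsub>P\<^esub> h' (snd x)"
    and "\<And>x. x \<in> carrier (dvect_sum K P') \<Longrightarrow> i' (fst (F x)) = snd x \<ominus>\<^bsub>P'\<^esub> h (snd (F x))"
proof -
  have spaces: "dvect_space K" "dvect_space P" "dvect_space P'" "dvect_space M"
    and i: "dvect_hom K P i" and \<pi>: "dvect_hom P M \<pi>" and \<pi>': "dvect_hom P' M \<pi>'"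
    using ex ex' by (simp_all add: short_exact_def)
  interpret P: dvect_space P by fact
  interpret M: dvect_space M by fact
  let ?S = "dvect_sum K P'"
  have S: "dvect_space ?S"
    by (intro dvect_space_sum spaces)
  \<comment> \<open>The component in \<open>P\<close>. Writing it with compositions matches the
    shape expected by \<open>hom_add\<close> and \<open>dvect_hom_comp\<close>.\<close>
  define u where "u = (\<lambda>x. (i \<circ> fst) x \<oplus>\<^bsub>P\<^esub> (h' \<circ> snd) x)"
  have u: "dvect_hom ?S P u"
    unfolding u_def
    by (intro P.hom_add dvect_hom_comp[OF dvect_hom_fst i] dvect_hom_comp[OF dvect_hom_snd h'])
  define v where "v = (\<lambda>x. snd x \<ominus>\<^bsub>P'\<^esub> (h \<circ> u) x)"
  have v: "dvect_hom ?S P' v"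
    unfolding v_def by (intro dvect_hom_diff S spaces dvect_hom_snd dvect_hom_comp[OF u h])
  \<comment> \<open>\<open>\<pi>\<close> kills the image of \<open>i\<close>, and \<open>h'\<close>
    lies over \<open>M\<close>.\<close>
  have \<pi>u: "\<pi> (u x) = \<pi>' (snd x)" if "x \<in> carrier ?S" for x
    using that by (auto simp: u_def dvect_homD(2)[OF \<pi>] dvect_homD(1)[OF i] dvect_homD(1)[OF h']
        dvect_homD(1)[OF \<pi>'] short_exact_comp_zero[OF ex] \<pi>h')
  \<comment> \<open>Since \<open>h\<close> lies over \<open>M\<close>, \<open>snd x\<close> and
    \<open>h (u x)\<close> have the same image in \<open>M\<close>; their difference
    \<open>v x\<close> therefore lifts through \<open>i'\<close>.\<close>
  have "\<pi>' (v x) = \<zero>\<^bsub>M\<^esub>" if x: "x \<in> carrier ?S" for x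
  proof -
    have "snd x \<in> carrier P'" "u x \<in> carrier P"
      using x dvect_homD(1)[OF u x] by auto
    then have "\<pi>' (v x) = \<pi>' (snd x) \<ominus>\<^bsub>M\<^esub> \<pi>' (snd x)" and "\<pi>' (snd x) \<in> carrier M"
      by (simp_all add: v_def dvect_hom_minus[OF spaces(3,4) \<pi>'] dvect_homD(1)[OF h]
          dvect_homD(1)[OF \<pi>'] \<pi>h \<pi>u[OF x])
    then show ?thesis
      by (simp add: a_minus_def M.r_neg)
  qed
  from short_exact_kernel_lift[OF ex' S v this] obtain k
    where k: "dvect_hom ?S K' k" and ik: "\<And>x. x \<in> carrier ?S \<Longrightarrow> i' (k x) = v x" by blast
  show thesis
    by (rule that[OF dvect_hom_Pair[OF k u]]) (simp_all only: fst_conv snd_conv ik u_def v_def comp_apply)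
qed

text \<open>One composite suffices, as the other follows by exchanging the two sequences together
  with \<open>F\<close> and \<open>G\<close>.\<close>

lemma schanuel_inverse:
  assumes ex: "short_exact K i P \<pi> M" and ex': "short_exact K' i' P' \<pi>' M"
    and h: "dvect_hom P P' h" and h': "dvect_hom P' P h'"
    and F: "dvect_hom (dvect_sum K P') (dvect_sum K' P) F"
      "\<And>x. x \<in> carrier (dvect_sum K P') \<Longrightarrow> snd (F x) = i (fst x) \<oplus>\<^bsub>P\<^esub> h' (snd x)"
      "\<And>x. x \<in> carrier (dvect_sum K P') \<Longrightarrow> i' (fst (F x)) = snd x \<ominus>\<^bsub>P'\<^esub> h (snd (F x))"
    and G: "dvect_hom (dvect_sum K' P) (dvect_sum K P') G"
      "\<And>y. y \<in> carrier (dvect_sum K' P) \<Longrightarrow> snd (G y) = i' (fst y) \<oplus>\<^bsub>P'\<^esub> h (snd y)"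
      "\<And>y. y \<in> carrier (dvect_sum K' P) \<Longrightarrow> i (fst (G y)) = snd y \<ominus>\<^bsub>P\<^esub> h' (snd (G y))"
    and x: "x \<in> carrier (dvect_sum K P')"
  shows "G (F x) = x"
proof -
  interpret P: dvect_space P using ex by (simp add: short_exact_def)
  interpret P': dvect_space P' using ex' by (simp add: short_exact_def)
  have i: "dvect_hom K P i" and inj: "inj_on i (carrier K)"
    using ex by (simp_all add: short_exact_def)
  have Fx: "F x \<in> carrier (dvect_sum K' P)"
    by (rule dvect_homD(1)[OF F(1) x])
  have GFx: "G (F x) \<in> carrier (dvect_sum K P')"
    by (rule dvect_homD(1)[OF G(1) Fx])
  have mem: "fst x \<in> carrier K" "snd x \<in> carrier P'" "snd (F x) \<in> carrier P" "fst (G (F x)) \<in> carrier K"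
    using x Fx GFx by (auto simp: mem_Times_iff)
  \<comment> \<open>With \<open>p = snd (F x)\<close> and \<open>p' = snd x\<close>, the equations
    for \<open>G\<close> and \<open>F\<close> give \<open>(p' - h p) + h p\<close>.\<close>
  have snd_eq: "snd (G (F x)) = snd x"
    using mem by (simp only: G(2)[OF Fx] F(3)[OF x] P'.diff_add_cancel dvect_homD(1)[OF h])
  \<comment> \<open>The first components are compared after applying \<open>i\<close>: subtracting
    \<open>h' (snd x)\<close> undoes its addition in \<open>snd (F x)\<close>.\<close>
  have "i (fst (G (F x))) = snd (F x) \<ominus>\<^bsub>P\<^esub> h' (snd x)"
    by (simp only: G(3)[OF Fx] snd_eq)
  also have "\<dots> = i (fst x)"
    using mem by (simp only: F(2)[OF x] P.add_diff_cancel dvect_homD(1)[OF h'] dvect_homD(1)[OF i])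
  finally have "fst (G (F x)) = fst x"
    using mem by (simp add: inj_on_eq_iff[OF inj])
  with snd_eq show ?thesis
    by (simp add: prod_eq_iff)
qed

theorem lemma7p1:
  fixes K P M K' P' :: "'a dvect"
    and i :: "'a \<Rightarrow> 'a" and \<pi> :: "'a \<Rightarrow> 'a" and i' :: "'a \<Rightarrow> 'a" and \<pi>' :: "'a \<Rightarrow> 'a"
  assumes "short_exact K i P \<pi> M"
    and "short_exact K' i' P' \<pi>' M"
    and "dvect_projective P"
    and "dvect_projective P'"
  shows "dvect_isomorphic (dvect_sum K P') (dvect_sum K' P)"
proof -
  note ex = assms(1) and ex' = assms(2)
  have spaces: "dvect_space K" "dvect_space P" "dvect_space K'" "dvect_space P'"
    and \<pi>: "dvect_hom P M \<pi>" and \<pi>': "dvect_hom P' M \<pi>'"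
    using ex ex' by (simp_all add: short_exact_def)
  from projective_lift[OF assms(3) ex' \<pi>] obtain h
    where h: "dvect_hom P P' h" and \<pi>h: "\<And>x. x \<in> carrier P \<Longrightarrow> \<pi>' (h x) = \<pi> x" by blast
  from projective_lift[OF assms(4) ex \<pi>'] obtain h'
    where h': "dvect_hom P' P h'" and \<pi>h': "\<And>x. x \<in> carrier P' \<Longrightarrow> \<pi> (h' x) = \<pi>' x" by blast
  obtain F where F: "dvect_hom (dvect_sum K P') (dvect_sum K' P) F"
      "\<And>x. x \<in> carrier (dvect_sum K P') \<Longrightarrow> snd (F x) = i (fst x) \<oplus>\<^bsub>P\<^esub> h' (snd x)"
      "\<And>x. x \<in> carrier (dvect_sum K P') \<Longrightarrow> i' (fst (F x)) = snd x \<ominus>\<^bsub>P'\<^esub> h (snd (F x))"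
    using schanuel_hom[OF ex ex' h \<pi>h h' \<pi>h'] by blast
  \<comment> \<open>The same construction with the primed and unprimed sequences exchanged.\<close>
  obtain G where G: "dvect_hom (dvect_sum K' P) (dvect_sum K P') G"
      "\<And>y. y \<in> carrier (dvect_sum K' P) \<Longrightarrow> snd (G y) = i' (fst y) \<oplus>\<^bsub>P'\<^esub> h (snd y)"
      "\<And>y. y \<in> carrier (dvect_sum K' P) \<Longrightarrow> i (fst (G y)) = snd y \<ominus>\<^bsub>P\<^esub> h' (snd (G y))"
    using schanuel_hom[OF ex' ex h' \<pi>h' h \<pi>h] by blast
  have "dvect_iso (dvect_sum K P') (dvect_sum K' P) F"
    using schanuel_inverse[OF ex ex' h h' F G] schanuel_inverse[OF ex' ex h' h G F]
    by (intro dvect_isoI[OF _ _ F(1) G(1)] dvect_space_sum spaces)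
  then show ?thesis
    unfolding dvect_isomorphic_def using dvect_space_sum spaces by blast
qed

end
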